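(* Let $\mathfrak{g}$ be a 2-nilpotent Lie algebra (that is, $[\mathfrak{g},[\mathfrak{g},\mathfrak{g}]]=\{0\}$) over a field of characteristic zero. Then the reduced Koszul map $\bar\eta:H_3(\mathfrak{g})\to\mathrm{Kill}(\mathfrak{g})$ is zero.
   Context: Tensor, exterior and symmetric powers are over the ground field. $H_*(\mathfrak{g})$ is the homology of the Chevalley–Eilenberg complex $\Lambda^*\mathfrak{g}$ with $\partial_n(x_1\wedge\dots\wedge x_n)=\sum_{i<j}(-1)^{i+j}[x_i,x_j]\wedge x_1\wedge\dots\wedge\hat{x_i}\wedge\dots\wedge\hat{x_j}\wedge\dots\wedge x_n$, and $Z_3(\mathfrak{g})=\ker\partial_3$. Writing $x\odot y$ for the product in the symmetric square $S^2\mathfrak{g}$, the Killing module $\mathrm{Kill}(\mathfrak{g})$ is the cokernel of $\mathfrak{g}^{\otimes 3}\to S^2\mathfrak{g}$, $x\otimes y\otimes z\mapsto [x,y]\odot z-x\odot[y,z]$. The Koszul map $\eta:\Lambda^3\mathfrak{g}\to\mathrm{Kill}(\mathfrak{g})$ sends $x\wedge y\wedge z$ to the class of $x\odot[y,z]$; it vanishes on 3-boundaries, and the reduced Koszul map $\bar\eta:H_3(\mathfrak{g})\to\mathrm{Kill}(\mathfrak{g})$ is induced by restricting $\eta$ to $Z_3(\mathfrak{g})$. Lie algebras are not assumed finite-dimensional. *)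

theory Defs
  imports Complex_Main "HOL-Library.Poly_Mapping" "HOL-Library.Set_Algebras"
    "HOL-Library.Multiset"
begin

text \<open>
  The free vector space on a type \<open>'x\<close> is the type \<open>'x \<Rightarrow>\<^sub>0 'k\<close> of finitely supported
  functions.
\<close>

definition fscale :: "'k::field \<Rightarrow> ('x \<Rightarrow>\<^sub>0 'k) \<Rightarrow> ('x \<Rightarrow>\<^sub>0 'k)"
  where "fscale c p = Poly_Mapping.map ((*) c) p"

lemma lookup_fscale [simp]: "Poly_Mapping.lookup (fscale c p) x = c * Poly_Mapping.lookup p x"
  by (simp add: fscale_def Poly_Mapping.map.rep_eq when_def)

interpretation free: vector_space "fscale :: 'k::field \<Rightarrow> ('x \<Rightarrow>\<^sub>0 'k) \<Rightarrow> ('x \<Rightarrow>\<^sub>0 'k)"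
  by standard (auto intro!: poly_mapping_eqI simp: lookup_add algebra_simps)

definition basis :: "'x \<Rightarrow> ('x \<Rightarrow>\<^sub>0 'k::field)"
  where "basis x = Poly_Mapping.single x 1"

definition lin_ext :: "('x \<Rightarrow> ('y \<Rightarrow>\<^sub>0 'k::field)) \<Rightarrow> ('x \<Rightarrow>\<^sub>0 'k) \<Rightarrow> ('y \<Rightarrow>\<^sub>0 'k)"
  where "lin_ext f p = (\<Sum>x\<in>Poly_Mapping.keys p. fscale (Poly_Mapping.lookup p x) (f x))"

text \<open>
  The elements of a quotient \<open>V / W\<close> are the cosets \<open>v +o W\<close>; the zero is \<open>W\<close> itself and
  addition is the addition of sets from \<open>Set_Algebras\<close>. Hence a quotient of (a subspace of) a
  quotient is again formed with the same operation. The map induced on a quotient by a map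
  constant on cosets takes the common value on each coset. The maps \<open>boundary\<close>,
  \<open>killing_map\<close>, \<open>koszul\<close> and \<open>reduced_koszul\<close> below are obtained in this way.
\<close>

definition quot :: "'v::plus set \<Rightarrow> 'v set \<Rightarrow> 'v set set"
  where "quot V W = (\<lambda>v. v +o W) ` V"

definition induced :: "('v \<Rightarrow> 'w) \<Rightarrow> 'v set \<Rightarrow> 'w"
  where "induced f C = the_elem (f ` C)"

locale lie_algebra = vector_space scale
  for scale :: "'k::field \<Rightarrow> 'g::ab_group_add \<Rightarrow> 'g"  (infixr \<open>*s\<close> 75) +
  fixes bracket :: "'g \<Rightarrow> 'g \<Rightarrow> 'g"
  assumes linear_right: "Vector_Spaces.linear scale scale (\<lambda>y. bracket x y)"
    and linear_left: "Vector_Spaces.linear scale scale (\<lambda>x. bracket x y)"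
    and alternating: "bracket x x = 0"
    and jacobi: "bracket x (bracket y z) + bracket y (bracket z x) + bracket z (bracket x y) = 0"
begin

definition bracket_space :: "'g set \<Rightarrow> 'g set \<Rightarrow> 'g set"
  where "bracket_space A B = span {bracket a b | a b. a \<in> A \<and> b \<in> B}"

definition two_nilpotent :: bool
  where "two_nilpotent \<longleftrightarrow> bracket_space UNIV (bracket_space UNIV UNIV) = {0}"

text \<open>
  Tensor, exterior and symmetric powers are presented by generators and relations: a list
  \<open>[x\<^sub>1, \<dots>, x\<^sub>n]\<close> stands for the product of its entries.
\<close>

definition words :: "nat \<Rightarrow> ('g list \<Rightarrow>\<^sub>0 'k) set"
  where "words n = {p. \<forall>xs\<in>Poly_Mapping.keys p. length xs = n}"

definition multilinear_gens :: "nat \<Rightarrow> ('g list \<Rightarrow>\<^sub>0 'k) set"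
  where "multilinear_gens n =
    {basis (us @ (a + b) # vs) - basis (us @ a # vs) - basis (us @ b # vs) | us vs a b.
       Suc (length us + length vs) = n} \<union>
    {basis (us @ (c *s a) # vs) - fscale c (basis (us @ a # vs)) | us vs a c.
       Suc (length us + length vs) = n}"

definition tensor_rels :: "nat \<Rightarrow> ('g list \<Rightarrow>\<^sub>0 'k) set"
  where "tensor_rels n = free.span (multilinear_gens n)"

definition exterior_rels :: "nat \<Rightarrow> ('g list \<Rightarrow>\<^sub>0 'k) set"
  where "exterior_rels n =
    free.span (multilinear_gens n \<union> {basis xs | xs. length xs = n \<and> \<not> distinct xs})"

definition symmetric_rels :: "nat \<Rightarrow> ('g list \<Rightarrow>\<^sub>0 'k) set"
  where "symmetric_rels n =
    free.span (multilinear_gens n \<union>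
      {basis xs - basis ys | xs ys. length xs = n \<and> mset xs = mset ys})"

definition tensor_power :: "nat \<Rightarrow> ('g list \<Rightarrow>\<^sub>0 'k) set set"
  where "tensor_power n = quot (words n) (tensor_rels n)"

definition exterior_power :: "nat \<Rightarrow> ('g list \<Rightarrow>\<^sub>0 'k) set set"
  where "exterior_power n = quot (words n) (exterior_rels n)"

definition symmetric_power :: "nat \<Rightarrow> ('g list \<Rightarrow>\<^sub>0 'k) set set"
  where "symmetric_power n = quot (words n) (symmetric_rels n)"

text \<open>
  Positions are counted from 0 rather than from 1, which leaves the sign \<open>(- 1) ^ (i + j)\<close>
  unchanged.
\<close>

definition boundary_word :: "'g list \<Rightarrow> ('g list \<Rightarrow>\<^sub>0 'k)"
  where "boundary_word xs =
    (\<Sum>(i, j) \<in> {(i, j). i < j \<and> j < length xs}.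
       fscale ((- 1) ^ (i + j)) (basis (bracket (xs ! i) (xs ! j) # nths xs (- {i, j}))))"

definition boundary :: "nat \<Rightarrow> ('g list \<Rightarrow>\<^sub>0 'k) set \<Rightarrow> ('g list \<Rightarrow>\<^sub>0 'k) set"
  where "boundary n = induced (\<lambda>p. lin_ext boundary_word p +o exterior_rels (n - 1))"

definition cycles :: "nat \<Rightarrow> ('g list \<Rightarrow>\<^sub>0 'k) set set"
  where "cycles n = {c \<in> exterior_power n. boundary n c = exterior_rels (n - 1)}"

definition boundaries :: "nat \<Rightarrow> ('g list \<Rightarrow>\<^sub>0 'k) set set"
  where "boundaries n = boundary (Suc n) ` exterior_power (Suc n)"

definition homology :: "nat \<Rightarrow> ('g list \<Rightarrow>\<^sub>0 'k) set set set"
  where "homology n = quot (cycles n) (boundaries n)"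

fun killing_word :: "'g list \<Rightarrow> ('g list \<Rightarrow>\<^sub>0 'k)"
  where "killing_word [x, y, z] = basis [bracket x y, z] - basis [x, bracket y z]"
  | "killing_word _ = 0"

definition killing_map :: "('g list \<Rightarrow>\<^sub>0 'k) set \<Rightarrow> ('g list \<Rightarrow>\<^sub>0 'k) set"
  where "killing_map = induced (\<lambda>p. lin_ext killing_word p +o symmetric_rels 2)"

definition Kill :: "('g list \<Rightarrow>\<^sub>0 'k) set set set"
  where "Kill = quot (symmetric_power 2) (killing_map ` tensor_power 3)"

definition Kill_class :: "('g list \<Rightarrow>\<^sub>0 'k) \<Rightarrow> ('g list \<Rightarrow>\<^sub>0 'k) set set"
  where "Kill_class p = (p +o symmetric_rels 2) +o killing_map ` tensor_power 3"

fun koszul_word :: "'g list \<Rightarrow> ('g list \<Rightarrow>\<^sub>0 'k)"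
  where "koszul_word [x, y, z] = basis [x, bracket y z]"
  | "koszul_word _ = 0"

definition koszul :: "('g list \<Rightarrow>\<^sub>0 'k) set \<Rightarrow> ('g list \<Rightarrow>\<^sub>0 'k) set set"
  where "koszul = induced (\<lambda>p. Kill_class (lin_ext koszul_word p))"

definition reduced_koszul :: "('g list \<Rightarrow>\<^sub>0 'k) set set \<Rightarrow> ('g list \<Rightarrow>\<^sub>0 'k) set set"
  where "reduced_koszul = induced koszul"

end

end

theory Submission
  imports Defs
begin

text \<open>
  Let \<open>P\<close> be a linear projection of the Lie algebra onto its centre, which contains all brackets,
  and let \<open>\<phi> (x \<wedge> y) = P x \<odot> y - x \<odot> P y\<close>. In the Killing module \<open>[x, y] \<odot> v = x \<odot> [y, v] = 0\<close> for
  central \<open>v\<close>, so \<open>\<phi> ([x, y] \<wedge> z) = [x, y] \<odot> z\<close>, and since \<open>x \<odot> [y, z]\<close> is invariant under cyclic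
  permutations and alternating, \<open>\<phi> \<circ> \<partial>\<^sub>3 = - 3 \<eta>\<close>. Hence \<open>\<eta>\<close> vanishes on cycles. On boundaries it
  vanishes because \<open>[x, y] \<odot> [z, w] = 0\<close>.
\<close>

section \<open>Linear extension on free vector spaces\<close>

lemma lin_ext_superset:
  assumes "finite A" "Poly_Mapping.keys p \<subseteq> A"
  shows "lin_ext f p = (\<Sum>x\<in>A. fscale (Poly_Mapping.lookup p x) (f x))"
  unfolding lin_ext_def
  by (rule sum.mono_neutral_left) (use assms in \<open>auto simp: in_keys_iff\<close>)

lemma lin_ext_zero [simp]: "lin_ext f 0 = 0"
  by (simp add: lin_ext_def)

lemma lin_ext_add: "lin_ext f (p + q) = lin_ext f p + lin_ext f q"
proof -
  \<comment> \<open>Coefficients may cancel in \<open>p + q\<close>, so the three supports differ;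
    all sums are taken over the union of the supports of \<open>p\<close> and
    \<open>q\<close>.\<close>
  let ?A = "Poly_Mapping.keys p \<union> Poly_Mapping.keys q"
  show ?thesis
    using lin_ext_superset[of ?A p f] lin_ext_superset[of ?A q f]
      lin_ext_superset[of ?A "p + q" f] keys_add[of p q]
    by (simp add: lookup_add free.scale_left_distrib sum.distrib)
qed

lemma lin_ext_fscale: "lin_ext f (fscale c p) = fscale c (lin_ext f p)"
proof -
  have "Poly_Mapping.keys (fscale c p) \<subseteq> Poly_Mapping.keys p"
    by (auto simp: in_keys_iff)
  then show ?thesis
    using lin_ext_superset[of "Poly_Mapping.keys p" "fscale c p" f]
    by (simp add: lin_ext_def[of f p] free.scale_sum_right)
qed

lemma lin_ext_uminus: "lin_ext f (- p) = - lin_ext f p"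
  using lin_ext_fscale[of f "- 1" p] by simp

lemma lin_ext_diff: "lin_ext f (p - q) = lin_ext f p - lin_ext f q"
  using lin_ext_add[of f p "- q"] by (simp add: lin_ext_uminus)

lemma lin_ext_sum: "lin_ext f (\<Sum>i\<in>I. p i) = (\<Sum>i\<in>I. lin_ext f (p i))"
  by (induction I rule: infinite_finite_induct) (simp_all add: lin_ext_add)

lemma lin_ext_basis [simp]: "lin_ext f (basis x) = f x"
  by (simp add: lin_ext_def basis_def)

lemma lin_ext_lin_ext: "lin_ext g (lin_ext f p) = lin_ext (\<lambda>x. lin_ext g (f x)) p"
  by (simp add: lin_ext_def[of f p] lin_ext_def[of "\<lambda>x. lin_ext g (f x)" p] lin_ext_sum
      lin_ext_fscale)

lemma lin_ext_add_fun: "lin_ext (\<lambda>x. f x + g x) p = lin_ext f p + lin_ext g p"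
  by (simp add: lin_ext_def free.scale_right_distrib sum.distrib)

lemma lin_ext_fscale_fun: "lin_ext (\<lambda>x. fscale c (f x)) p = fscale c (lin_ext f p)"
  by (simp add: lin_ext_def free.scale_sum_right mult.commute)

lemma lin_ext_in_subspace:
  assumes "free.subspace R" "\<And>x. x \<in> Poly_Mapping.keys p \<Longrightarrow> f x \<in> R"
  shows "lin_ext f p \<in> R"
  unfolding lin_ext_def
  using assms by (intro free.subspace_sum) (auto intro: free.subspace_scale)

text \<open>The preimage of a subspace under a linear map is a subspace, so it contains the span
  once it contains \<open>G\<close>. This reduces the checks of well-definedness to
  generators.\<close>

lemma lin_ext_span:
  assumes R: "free.subspace R" and G: "\<And>g. g \<in> G \<Longrightarrow> lin_ext f g \<in> R"
    and p: "p \<in> free.span G"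
  shows "lin_ext f p \<in> R"
proof -
  have "free.subspace {p. lin_ext f p \<in> R}"
    using R by (auto simp: free.subspace_def lin_ext_add lin_ext_fscale)
  then show ?thesis
    using free.span_minimal[of G "{p. lin_ext f p \<in> R}"] G p by auto
qed

section \<open>Cosets and maps induced on them\<close>

lemma coset_eq:
  assumes "free.subspace R" "p - q \<in> R"
  shows "p +o R = q +o R"
proof -
  have "x - p \<in> R \<longleftrightarrow> x - q \<in> R" for x
    using free.subspace_add[OF assms(1) _ assms(2), of "x - p"]
      free.subspace_diff[OF assms(1) _ assms(2), of "x - q"] by auto
  then show ?thesis
    unfolding set_eq_iff elt_set_plus_def mem_Collect_eq
    by (metis add_diff_cancel_left' diff_add_cancel add.commute)
qed

lemma coset_eqD:
  assumes "free.subspace R" "p +o R = R"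
  shows "p \<in> R"
proof -
  have "p + 0 \<in> p +o R"
    by (intro set_plus_intro2 free.subspace_0 assms)
  then show ?thesis using assms(2) by simp
qed

lemma coset_add:
  assumes "free.subspace R"
  shows "(p +o R) + (q +o R) = (p + q) +o R"
proof -
  have "R + R = R"
  proof
    show "R + R \<subseteq> R"
      by (auto simp: set_plus_def intro: free.subspace_add[OF assms])
    show "R \<subseteq> R + R"
      using free.subspace_0[OF assms] set_plus_intro[of 0 R] by fastforce
  qed
  then show ?thesis by (simp add: set_plus_rearrange)
qed

text \<open>The image of the coset is a singleton, nonempty because \<open>0\<close> lies in
  \<open>R\<close>, so \<open>the_elem\<close> returns the common value. The maps
  \<open>boundary\<close>, \<open>killing_map\<close> and \<open>koszul\<close> are all evaluated on
  representatives in this way.\<close>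

lemma induced_coset:
  assumes "free.subspace R" "\<And>r. r \<in> R \<Longrightarrow> f (p + r) = f p"
  shows "induced f (p +o R) = f p"
proof -
  have "f ` (p +o R) = {f p}"
    using assms(2) free.subspace_0[OF assms(1)] unfolding elt_set_plus_def by force
  then show ?thesis by (simp add: induced_def)
qed

lemma length_2_cases:
  assumes "length xs = 2" obtains a b where "xs = [a, b]"
  using assms by (auto simp: eval_nat_numeral length_Suc_conv)

lemma length_3_cases:
  assumes "length xs = 3" obtains a b c where "xs = [a, b, c]"
  using assms by (auto simp: eval_nat_numeral length_Suc_conv)

lemma length_4_cases:
  assumes "length xs = 4" obtains a b c d where "xs = [a, b, c, d]"
  using assms by (auto simp: eval_nat_numeral length_Suc_conv)

context lie_algebra
begin

section \<open>The bracket, the relations of the powers, and maps respecting these relations\<close>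

lemma bracket_add_left: "bracket (a + b) y = bracket a y + bracket b y"
  and bracket_scale_left: "bracket (c *s a) y = c *s bracket a y"
  using linear_left[of y] by (simp_all add: Vector_Spaces.linear_iff)

lemma bracket_add_right: "bracket x (a + b) = bracket x a + bracket x b"
  and bracket_scale_right: "bracket x (c *s a) = c *s bracket x a"
  using linear_right[of x] by (simp_all add: Vector_Spaces.linear_iff)

lemmas bracket_linear =
  bracket_add_left bracket_scale_left bracket_add_right bracket_scale_right

lemma bracket_anticommute: "bracket y x = - bracket x y"
proof -
  have "bracket (x + y) (x + y) = bracket x x + bracket x y + (bracket y x + bracket y y)"
    by (simp only: bracket_add_left bracket_add_right add.assoc add.left_commute)
  then show ?thesis
    by (simp add: alternating add_eq_0_iff)
qed

lemma add_gen:
  assumes "Suc (length us + length vs) = n"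
  shows "basis (us @ (a + b) # vs) - basis (us @ a # vs) - basis (us @ b # vs) \<in> tensor_rels n"
  unfolding tensor_rels_def multilinear_gens_def
  by (rule free.span_base) (use assms in blast)

lemma scale_gen:
  assumes "Suc (length us + length vs) = n"
  shows "basis (us @ (c *s a) # vs) - fscale c (basis (us @ a # vs)) \<in> tensor_rels n"
  unfolding tensor_rels_def multilinear_gens_def
  by (rule free.span_base) (use assms in blast)

lemma tensor_rels_subset_exterior_rels: "tensor_rels n \<subseteq> exterior_rels n"
  unfolding tensor_rels_def exterior_rels_def by (rule free.span_mono) blast

lemma tensor_rels_subset_symmetric_rels: "tensor_rels n \<subseteq> symmetric_rels n"
  unfolding tensor_rels_def symmetric_rels_def by (rule free.span_mono) blast

lemma subspace_tensor_rels: "free.subspace (tensor_rels n)"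
  unfolding tensor_rels_def by (rule free.subspace_span)

lemma subspace_exterior_rels: "free.subspace (exterior_rels n)"
  unfolding exterior_rels_def by (rule free.subspace_span)

lemma subspace_symmetric_rels: "free.subspace (symmetric_rels n)"
  unfolding symmetric_rels_def by (rule free.subspace_span)

text \<open>Working modulo \<open>R\<close> lets maps into a quotient be handled through
  representatives in the free space. The condition is exactly that the linear extension of
  \<open>f\<close> sends the multilinearity generators into \<open>R\<close>.\<close>

definition multilinear_mod ::
    "nat \<Rightarrow> ('g list \<Rightarrow>\<^sub>0 'k) set \<Rightarrow> ('g list \<Rightarrow> ('g list \<Rightarrow>\<^sub>0 'k)) \<Rightarrow> bool"
  where "multilinear_mod n R f \<longleftrightarrow>
    (\<forall>us vs. Suc (length us + length vs) = n \<longrightarrow>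
      (\<forall>a b. f (us @ (a + b) # vs) - f (us @ a # vs) - f (us @ b # vs) \<in> R) \<and>
      (\<forall>c a. f (us @ (c *s a) # vs) - fscale c (f (us @ a # vs)) \<in> R))"

lemma multilinear_modD:
  assumes "multilinear_mod n R f" "Suc (length us + length vs) = n"
  shows "f (us @ (a + b) # vs) - f (us @ a # vs) - f (us @ b # vs) \<in> R"
    and "f (us @ (c *s a) # vs) - fscale c (f (us @ a # vs)) \<in> R"
  using assms unfolding multilinear_mod_def by blast+

lemma multilinear_mod_add:
  assumes R: "free.subspace R" and f: "multilinear_mod n R f" and g: "multilinear_mod n R g"
  shows "multilinear_mod n R (\<lambda>xs. f xs + g xs)"
  unfolding multilinear_mod_def
proof (intro allI impI conjI)
  fix us vs :: "'g list" assume n: "Suc (length us + length vs) = n"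
  show "f (us @ (a + b) # vs) + g (us @ (a + b) # vs) - (f (us @ a # vs) + g (us @ a # vs)) -
      (f (us @ b # vs) + g (us @ b # vs)) \<in> R" for a b
    using free.subspace_add[OF R multilinear_modD(1)[OF f n, of a b] multilinear_modD(1)[OF g n, of a b]]
    by (simp add: algebra_simps)
  show "f (us @ (c *s a) # vs) + g (us @ (c *s a) # vs) -
      fscale c (f (us @ a # vs) + g (us @ a # vs)) \<in> R" for a c
    using free.subspace_add[OF R multilinear_modD(2)[OF f n, of c a] multilinear_modD(2)[OF g n, of c a]]
    by (simp add: algebra_simps free.scale_right_distrib)
qed

lemma multilinear_mod_fscale:
  assumes R: "free.subspace R" and f: "multilinear_mod n R f"
  shows "multilinear_mod n R (\<lambda>xs. fscale d (f xs))"
  unfolding multilinear_mod_def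
proof (intro allI impI conjI)
  fix us vs :: "'g list" assume n: "Suc (length us + length vs) = n"
  show "fscale d (f (us @ (a + b) # vs)) - fscale d (f (us @ a # vs)) -
      fscale d (f (us @ b # vs)) \<in> R" for a b
    using free.subspace_scale[OF R multilinear_modD(1)[OF f n, of a b], of d]
    by (simp add: free.scale_right_diff_distrib)
  show "fscale d (f (us @ (c *s a) # vs)) - fscale c (fscale d (f (us @ a # vs))) \<in> R" for a c
    using free.subspace_scale[OF R multilinear_modD(2)[OF f n, of c a], of d]
    by (simp add: free.scale_right_diff_distrib mult.commute)
qed

lemma multilinear_mod_zero: "free.subspace R \<Longrightarrow> multilinear_mod n R (\<lambda>xs. 0)"
  by (simp add: multilinear_mod_def free.subspace_0)

lemma multilinear_mod_sum:
  assumes "free.subspace R" "\<And>i. i \<in> I \<Longrightarrow> multilinear_mod n R (f i)"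
  shows "multilinear_mod n R (\<lambda>xs. \<Sum>i\<in>I. f i xs)"
  using assms(2)
  by (induction I rule: infinite_finite_induct)
    (simp_all add: multilinear_mod_zero multilinear_mod_add assms(1))

text \<open>Multilinearity looks only at words of length \<open>n\<close>. Hence a function given by
  pattern matching, such as \<open>koszul_word\<close>, may be exchanged for an expression in the
  entries \<open>xs ! i\<close>.\<close>

lemma multilinear_mod_cong:
  assumes "multilinear_mod n R f" "\<And>xs. length xs = n \<Longrightarrow> g xs = f xs"
  shows "multilinear_mod n R g"
  using assms unfolding multilinear_mod_def by simp

lemma lin_ext_multilinear_gens:
  assumes "multilinear_mod n R f" "g \<in> multilinear_gens n"
  shows "lin_ext f g \<in> R"
  using assms unfolding multilinear_gens_def
  by (auto simp: lin_ext_diff lin_ext_fscale multilinear_modD)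

lemma lin_ext_tensor_rels:
  assumes "free.subspace R" "multilinear_mod n R f" "p \<in> tensor_rels n"
  shows "lin_ext f p \<in> R"
  using lin_ext_span[OF assms(1) _ assms(3)[unfolded tensor_rels_def]]
    lin_ext_multilinear_gens[OF assms(2)] by blast

text \<open>This is the universal property of the exterior power on representatives: multilinear and
  alternating modulo \<open>R\<close> suffices, since these are the two kinds of generators.\<close>

lemma lin_ext_exterior_rels:
  assumes "free.subspace R" "multilinear_mod n R f"
    and "\<And>xs. length xs = n \<Longrightarrow> \<not> distinct xs \<Longrightarrow> f xs \<in> R"
    and "p \<in> exterior_rels n"
  shows "lin_ext f p \<in> R"
  by (rule lin_ext_span[OF assms(1) _ assms(4)[unfolded exterior_rels_def]])
    (auto intro: lin_ext_multilinear_gens[OF assms(2)] assms(3))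

lemma multilinear_mod_mono: "multilinear_mod n R f \<Longrightarrow> R \<subseteq> R' \<Longrightarrow> multilinear_mod n R' f"
  unfolding multilinear_mod_def by blast

lemma zero_in_tensor_rels:
  "Suc (length us + length vs) = n \<Longrightarrow> basis (us @ 0 # vs) \<in> tensor_rels n"
  using scale_gen[of us vs n 0 0] by simp

lemma neg_in_tensor_rels:
  "Suc (length us + length vs) = n \<Longrightarrow>
    basis (us @ (- a) # vs) + basis (us @ a # vs) \<in> tensor_rels n"
  using scale_gen[of us vs n "- 1" a] by simp

lemma repeated_in_exterior_rels:
  "length xs = n \<Longrightarrow> \<not> distinct xs \<Longrightarrow> basis xs \<in> exterior_rels n"
  unfolding exterior_rels_def by (rule free.span_base) blast

lemma permuted_in_symmetric_rels:
  "length xs = n \<Longrightarrow> mset xs = mset ys \<Longrightarrow> basis xs - basis ys \<in> symmetric_rels n"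
  unfolding symmetric_rels_def by (rule free.span_base) blast

text \<open>The exterior relations mention only repeated entries; antisymmetry follows by
  polarization, expanding the word with \<open>a + b\<close> in both adjacent places.\<close>

lemma swap_in_exterior_rels:
  assumes "length us + length vs + 2 = n"
  shows "basis (us @ a # b # vs) + basis (us @ b # a # vs) \<in> exterior_rels n"
proof -
  let ?E = "exterior_rels n" and ?w = "\<lambda>x y. basis (us @ x # y # vs) :: 'g list \<Rightarrow>\<^sub>0 'k"
  have l: "?w (a + b) y - ?w a y - ?w b y \<in> ?E" for y
    using add_gen[of us "y # vs" n a b] tensor_rels_subset_exterior_rels assms by auto
  have r: "?w x (a + b) - ?w x a - ?w x b \<in> ?E" for x
    using add_gen[of "us @ [x]" vs n a b] tensor_rels_subset_exterior_rels assms by auto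
  have d: "?w x x \<in> ?E" for x
    using assms by (intro repeated_in_exterior_rels) auto
  have "?w a b + ?w b a =
      ?w (a + b) (a + b) - ?w a a - ?w b b - (?w (a + b) (a + b) - ?w a (a + b) - ?w b (a + b))
      - (?w a (a + b) - ?w a a - ?w a b) - (?w b (a + b) - ?w b a - ?w b b)"
    by (simp add: algebra_simps)
  also have "\<dots> \<in> ?E"
    by (intro free.subspace_diff[OF subspace_exterior_rels] l r d)
  finally show ?thesis .
qed


section \<open>Multilinearity of the Koszul, Killing and boundary words\<close>

lemma multilinear_mod_2I:
  assumes "\<And>a b y. f [a + b, y] - f [a, y] - f [b, y] \<in> R"
    and "\<And>c a y. f [c *s a, y] - fscale c (f [a, y]) \<in> R"
    and "\<And>a b x. f [x, a + b] - f [x, a] - f [x, b] \<in> R"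
    and "\<And>c a x. f [x, c *s a] - fscale c (f [x, a]) \<in> R"
  shows "multilinear_mod 2 R f"
  unfolding multilinear_mod_def
proof (intro allI impI)
  fix us vs :: "'g list" assume "Suc (length us + length vs) = 2"
  then consider y where "us = []" "vs = [y]" | x where "us = [x]" "vs = []"
    by (cases us; cases vs) auto
  then show "(\<forall>a b. f (us @ (a + b) # vs) - f (us @ a # vs) - f (us @ b # vs) \<in> R) \<and>
      (\<forall>c a. f (us @ (c *s a) # vs) - fscale c (f (us @ a # vs)) \<in> R)"
    by cases (simp_all add: assms)
qed

lemma multilinear_mod_3I:
  assumes "\<And>a b y z. f [a + b, y, z] - f [a, y, z] - f [b, y, z] \<in> R"
    and "\<And>c a y z. f [c *s a, y, z] - fscale c (f [a, y, z]) \<in> R"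
    and "\<And>a b x z. f [x, a + b, z] - f [x, a, z] - f [x, b, z] \<in> R"
    and "\<And>c a x z. f [x, c *s a, z] - fscale c (f [x, a, z]) \<in> R"
    and "\<And>a b x y. f [x, y, a + b] - f [x, y, a] - f [x, y, b] \<in> R"
    and "\<And>c a x y. f [x, y, c *s a] - fscale c (f [x, y, a]) \<in> R"
  shows "multilinear_mod 3 R f"
  unfolding multilinear_mod_def
proof (intro allI impI)
  fix us vs :: "'g list" assume "Suc (length us + length vs) = 3"
  then consider y z where "us = []" "vs = [y, z]" | x z where "us = [x]" "vs = [z]"
    | x y where "us = [x, y]" "vs = []"
    by (cases us; cases "tl us"; cases vs; cases "tl vs") auto
  then show "(\<forall>a b. f (us @ (a + b) # vs) - f (us @ a # vs) - f (us @ b # vs) \<in> R) \<and>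
      (\<forall>c a. f (us @ (c *s a) # vs) - fscale c (f (us @ a # vs)) \<in> R)"
    by cases (simp_all add: assms)
qed

lemmas add_gens_2 =
  add_gen[of "[]" "[z]" 2 for z, simplified] add_gen[of "[z]" "[]" 2 for z, simplified]
lemmas scale_gens_2 =
  scale_gen[of "[]" "[z]" 2 for z, simplified] scale_gen[of "[z]" "[]" 2 for z, simplified]

lemma multilinear_mod_bracket_left:
  "multilinear_mod 3 (tensor_rels 2) (\<lambda>xs. basis [bracket (xs ! 0) (xs ! 1), xs ! 2])"
  by (rule multilinear_mod_3I) (simp_all add: bracket_linear add_gens_2 scale_gens_2)

lemma multilinear_mod_bracket_right:
  "multilinear_mod 3 (tensor_rels 2) (\<lambda>xs. basis [xs ! 0, bracket (xs ! 1) (xs ! 2)])"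
  by (rule multilinear_mod_3I) (simp_all add: bracket_linear add_gens_2 scale_gens_2)

lemma multilinear_mod_koszul_word: "multilinear_mod 3 (tensor_rels 2) koszul_word"
  by (rule multilinear_mod_cong[OF multilinear_mod_bracket_right]) (auto elim: length_3_cases)

lemma multilinear_mod_killing_word: "multilinear_mod 3 (tensor_rels 2) killing_word"
  by (rule multilinear_mod_cong[OF multilinear_mod_add[OF subspace_tensor_rels
          multilinear_mod_bracket_left multilinear_mod_fscale[OF subspace_tensor_rels
            multilinear_mod_bracket_right, of "- 1"]]])
    (auto elim: length_3_cases)

text \<open>The varying entry stands at position \<open>i\<close>, at position \<open>j\<close> or
  elsewhere. In each case exactly one entry of the resulting word depends on it, and linearly: the
  bracket in front in the first two cases, the entry itself in the third.\<close>

lemma multilinear_mod_bracket_term: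
  assumes ij: "i < j" "j < n"
  shows "multilinear_mod n (tensor_rels (n - 1))
    (\<lambda>xs. basis (bracket (xs ! i) (xs ! j) # nths xs (- {i, j})))"
  unfolding multilinear_mod_def
proof (intro allI impI)
  fix us vs :: "'g list" assume n: "Suc (length us + length vs) = n"
  let ?f = "\<lambda>xs. basis (bracket (xs ! i) (xs ! j) # nths xs (- {i, j})) :: 'g list \<Rightarrow>\<^sub>0 'k"
  let ?m = "length us"
  let ?I = "{k. k < n \<and> k \<in> - {i, j}}"
  \<comment> \<open>Deleting two distinct positions leaves \<open>n - 2\<close> entries, so with the
    bracket in front the term has length \<open>n - 1\<close>.\<close>
  have "?I = {..<n} - {i, j}" by auto
  then have "card ?I = n - 2"
    using ij by (simp add: card_Diff_subset)
  then have len: "length (nths (us @ a # vs) (- {i, j})) = n - 2" for a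
    using n by (simp add: length_nths)
  let ?w = "\<lambda>us' vs'. Suc (length us' + length vs') = n - 1"
  consider "?m = i" | "?m = j" | "?m \<noteq> i" "?m \<noteq> j" by blast
  then obtain us' vs' h where "?w us' vs'" "\<And>a. ?f (us @ a # vs) = basis (us' @ h a # vs')"
    "\<And>a b. h (a + b) = h a + h b" "\<And>c a. h (c *s a) = c *s h a"
  proof cases
    case 1
    let ?v = "nths us (- {i, j}) @ nths vs {k. Suc k + ?m \<in> - {i, j}}"
    show thesis
    \<comment> \<open>The \<open>0\<close> is a placeholder for the varying entry: position
      \<open>j\<close> lies elsewhere, so the value read there does not depend on it.\<close>
    proof (rule that[of "[]" ?v "\<lambda>a. bracket a ((us @ 0 # vs) ! j)"])
      show "?w [] ?v"
        using len[of 0] 1 ij by (simp add: nths_append nths_Cons)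
    qed (use 1 ij in \<open>auto simp: nths_append nths_Cons nth_append nth_Cons bracket_linear split: nat.split\<close>)
  next
    case 2
    let ?v = "nths us (- {i, j}) @ nths vs {k. Suc k + ?m \<in> - {i, j}}"
    show thesis
    proof (rule that[of "[]" ?v "\<lambda>a. bracket ((us @ 0 # vs) ! i) a"])
      show "?w [] ?v"
        using len[of 0] 2 ij by (simp add: nths_append nths_Cons)
    qed (use 2 ij in \<open>auto simp: nths_append nths_Cons nth_append nth_Cons bracket_linear split: nat.split\<close>)
  next
    case 3
    let ?u = "bracket ((us @ 0 # vs) ! i) ((us @ 0 # vs) ! j) # nths us (- {i, j})"
    let ?v = "nths vs {k. Suc k + ?m \<in> - {i, j}}"
    show thesis
    proof (rule that[of ?u ?v "\<lambda>a. a"])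
      show "?w ?u ?v"
        using len[of 0] 3 ij by (simp add: nths_append nths_Cons)
    qed (use 3 ij in \<open>auto simp: nths_append nths_Cons nth_append nth_Cons split: nat.split\<close>)
  qed
  then show "(\<forall>a b. ?f (us @ (a + b) # vs) - ?f (us @ a # vs) - ?f (us @ b # vs) \<in> tensor_rels (n - 1)) \<and>
      (\<forall>c a. ?f (us @ (c *s a) # vs) - fscale c (?f (us @ a # vs)) \<in> tensor_rels (n - 1))"
    by (simp add: add_gen scale_gen)
qed

lemma multilinear_mod_boundary_word: "multilinear_mod n (tensor_rels (n - 1)) boundary_word"
proof -
  let ?I = "{(i, j). i < j \<and> j < n}"
  have "multilinear_mod n (tensor_rels (n - 1)) (\<lambda>xs. \<Sum>p\<in>?I.
      fscale ((- 1) ^ (fst p + snd p))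
        (basis (bracket (xs ! fst p) (xs ! snd p) # nths xs (- {fst p, snd p}))))"
    by (intro multilinear_mod_sum multilinear_mod_fscale subspace_tensor_rels
        multilinear_mod_bracket_term) auto
  then show ?thesis
    by (rule multilinear_mod_cong) (simp add: boundary_word_def case_prod_unfold)
qed

section \<open>The Chevalley-Eilenberg boundary in degrees 3 and 4\<close>

lemma boundary_word_3:
  "boundary_word [a, b, c] =
    - basis [bracket a b, c] + basis [bracket a c, b] - basis [bracket b c, a]"
proof -
  have "{(i, j). i < j \<and> j < length [a, b, c]} = {(0, 1), (0, 2), (1, 2)}" by auto
  then show ?thesis
    unfolding boundary_word_def by (simp only:) (simp add: nths_Cons)
qed

lemma boundary_word_4:
  "boundary_word [a, b, c, d] =
    - basis [bracket a b, c, d] + basis [bracket a c, b, d] - basis [bracket a d, b, c]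
    - basis [bracket b c, a, d] + basis [bracket b d, a, c] - basis [bracket c d, a, b]"
proof -
  have "{(i, j). i < j \<and> j < length [a, b, c, d]} = {(0, 1), (0, 2), (0, 3), (1, 2), (1, 3), (2, 3)}"
    by auto
  then show ?thesis
    unfolding boundary_word_def by (simp only:) (simp add: nths_Cons)
qed


text \<open>The bracket of the two equal entries is zero. The other two terms cancel, literally if
  the equal entries are adjacent and after one use of anticommutativity if they are the outer
  ones.\<close>

lemma boundary_word_3_exterior:
  assumes "length xs = 3" "\<not> distinct xs"
  shows "boundary_word xs \<in> exterior_rels 2"
proof -
  let ?E = "exterior_rels 2 :: ('g list \<Rightarrow>\<^sub>0 'k) set"
  obtain a b c where xs: "xs = [a, b, c]" using assms(1) by (rule length_3_cases)
  have zero: "basis [0, z] \<in> ?E" for z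
    using zero_in_tensor_rels[of "[]" "[z]" 2] tensor_rels_subset_exterior_rels by auto
  have neg: "basis [- x, z] + basis [x, z] \<in> ?E" for x z
    using neg_in_tensor_rels[of "[]" "[z]" 2] tensor_rels_subset_exterior_rels by auto
  note mem = zero neg free.subspace_neg[OF subspace_exterior_rels]
    free.subspace_add[OF subspace_exterior_rels] free.subspace_diff[OF subspace_exterior_rels]
  consider "a = b" | "a = c" | "b = c" using assms(2) xs by auto
  then show ?thesis
  proof cases
    case 1
    then have "boundary_word xs = - basis [0, c]"
      by (simp add: xs boundary_word_3 alternating)
    then show ?thesis by (simp only:) (intro mem)
  next
    case 2
    then have "boundary_word xs = basis [0, b] - (basis [- bracket a b, a] + basis [bracket a b, a])"
      by (simp add: xs boundary_word_3 alternating bracket_anticommute[of b c])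
    then show ?thesis by (simp only:) (intro mem)
  next
    case 3
    then have "boundary_word xs = - basis [0, a]"
      by (simp add: xs boundary_word_3 alternating)
    then show ?thesis by (simp only:) (intro mem)
  qed
qed

text \<open>The bracket of the two equal entries is zero, and the term of the complementary pair
  keeps both equal entries. The remaining four terms cancel in pairs, up to anticommutativity of the
  bracket and swaps of the last two entries.\<close>

lemma boundary_word_4_exterior:
  assumes "length xs = 4" "\<not> distinct xs"
  shows "boundary_word xs \<in> exterior_rels 3"
proof -
  let ?E = "exterior_rels 3 :: ('g list \<Rightarrow>\<^sub>0 'k) set"
  obtain a b c d where xs: "xs = [a, b, c, d]" using assms(1) by (rule length_4_cases)
  have zero: "basis [0, y, z] \<in> ?E" for y z
    using zero_in_tensor_rels[of "[]" "[y, z]" 3] tensor_rels_subset_exterior_rels by auto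
  have neg: "basis [- x, y, z] + basis [x, y, z] \<in> ?E" for x y z
    using neg_in_tensor_rels[of "[]" "[y, z]" 3] tensor_rels_subset_exterior_rels by auto
  have swap: "basis [x, y, z] + basis [x, z, y] \<in> ?E" for x y z
    using swap_in_exterior_rels[of "[x]" "[]" 3] by simp
  have rep: "basis [x, y, y] \<in> ?E" for x y
    by (rule repeated_in_exterior_rels) auto
  note mem = zero neg swap rep free.subspace_neg[OF subspace_exterior_rels]
    free.subspace_add[OF subspace_exterior_rels] free.subspace_diff[OF subspace_exterior_rels]
  consider "a = b" | "a = c" | "a = d" | "b = c" | "b = d" | "c = d" using assms(2) xs by auto
  then show ?thesis
  proof cases
    case 1
    then have "boundary_word xs = - basis [0, c, d] - basis [bracket c d, a, a]"
      by (simp add: xs boundary_word_4 alternating)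
    then show ?thesis by (simp only:) (intro mem)
  next
    case 2
    then have "boundary_word xs = basis [0, b, d]
        - (basis [- bracket a b, a, d] + basis [bracket a b, a, d])
        - (basis [bracket a d, a, b] + basis [bracket a d, b, a]) + basis [bracket b d, a, a]"
      by (simp add: xs boundary_word_4 alternating bracket_anticommute[of b c])
    then show ?thesis by (simp only:) (intro mem)
  next
    case 3
    \<comment> \<open>The words \<open>[bracket a b, a, c]\<close> and
      \<open>[bracket a c, a, b]\<close> are inserted with both signs, since here a pair cancels
      only after both a sign change of the bracket and a swap.\<close>
    then have "boundary_word xs = - basis [0, b, c] - basis [bracket b c, a, a]
        - (basis [bracket a b, c, a] + basis [bracket a b, a, c])
        + (basis [- bracket a b, a, c] + basis [bracket a b, a, c])
        - (basis [- bracket a c, a, b] + basis [bracket a c, a, b])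
        + (basis [bracket a c, a, b] + basis [bracket a c, b, a])"
      by (simp add: xs boundary_word_4 alternating bracket_anticommute[of b d]
          bracket_anticommute[of c d])
    then show ?thesis by (simp only:) (intro mem)
  next
    case 4
    then have "boundary_word xs = - basis [bracket a d, b, b] - basis [0, a, d]"
      by (simp add: xs boundary_word_4 alternating)
    then show ?thesis by (simp only:) (intro mem)
  next
    case 5
    then have "boundary_word xs = - (basis [bracket a b, c, b] + basis [bracket a b, b, c])
        + basis [bracket a c, b, b] + basis [0, a, c]
        - (basis [- bracket b c, a, b] + basis [bracket b c, a, b])"
      by (simp add: xs boundary_word_4 alternating bracket_anticommute[of c d])
    then show ?thesis by (simp only:) (intro mem)
  next
    case 6
    then have "boundary_word xs = - basis [bracket a b, c, c] - basis [0, a, b]"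
      by (simp add: xs boundary_word_4 alternating)
    then show ?thesis by (simp only:) (intro mem)
  qed
qed

text \<open>Multilinearity is known in every degree; alternation enters as an assumption because it
  is verified by explicit expansion in degrees 3 and 4.\<close>

lemma boundary_coset:
  assumes "\<And>xs. length xs = n \<Longrightarrow> \<not> distinct xs \<Longrightarrow> boundary_word xs \<in> exterior_rels (n - 1)"
  shows "boundary n (p +o exterior_rels n) = lin_ext boundary_word p +o exterior_rels (n - 1)"
  unfolding boundary_def
proof (rule induced_coset[OF subspace_exterior_rels])
  fix r assume "r \<in> exterior_rels n"
  then have "lin_ext boundary_word r \<in> exterior_rels (n - 1)"
    by (intro lin_ext_exterior_rels[OF subspace_exterior_rels multilinear_mod_mono[OF
            multilinear_mod_boundary_word tensor_rels_subset_exterior_rels]] assms)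
  then show "lin_ext boundary_word (p + r) +o exterior_rels (n - 1) =
      lin_ext boundary_word p +o exterior_rels (n - 1)"
    by (intro coset_eq subspace_exterior_rels) (simp add: lin_ext_add)
qed

section \<open>The Killing module and the Koszul map on representatives\<close>

definition killing_rels :: "('g list \<Rightarrow>\<^sub>0 'k) set"
  where "killing_rels = free.span (symmetric_rels 2 \<union> {killing_word [x, y, z] | x y z. True})"

lemma subspace_killing_rels: "free.subspace killing_rels"
  unfolding killing_rels_def by (rule free.subspace_span)

lemma symmetric_rels_subset_killing_rels: "symmetric_rels 2 \<subseteq> killing_rels"
  unfolding killing_rels_def using free.span_superset by blast

lemma tensor_rels_subset_killing_rels: "tensor_rels 2 \<subseteq> killing_rels"
  using tensor_rels_subset_symmetric_rels symmetric_rels_subset_killing_rels by blast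

lemma killing_word_in_killing_rels: "basis [bracket x y, z] - basis [x, bracket y z] \<in> killing_rels"
proof -
  have "killing_word [x, y, z] \<in> killing_rels"
    unfolding killing_rels_def by (rule free.span_base) blast
  then show ?thesis by simp
qed

lemma killing_map_coset: "killing_map (p +o tensor_rels 3) = lin_ext killing_word p +o symmetric_rels 2"
  unfolding killing_map_def
proof (rule induced_coset[OF subspace_tensor_rels])
  fix r assume "r \<in> tensor_rels 3"
  then have "lin_ext killing_word r \<in> symmetric_rels 2"
    by (intro lin_ext_tensor_rels[OF subspace_symmetric_rels multilinear_mod_mono[OF
            multilinear_mod_killing_word tensor_rels_subset_symmetric_rels]])
  then show "lin_ext killing_word (p + r) +o symmetric_rels 2 = lin_ext killing_word p +o symmetric_rels 2"
    by (intro coset_eq subspace_symmetric_rels) (simp add: lin_ext_add)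
qed

text \<open>Every element of the image of \<open>killing_map\<close> is represented by some
  \<open>lin_ext killing_word q\<close>, and adding cosets adds representatives. The two-stage
  quotient is thereby described by elements of the free space.\<close>

lemma Kill_class_eq: "Kill_class p = {(p + lin_ext killing_word q) +o symmetric_rels 2 | q. q \<in> words 3}"
  unfolding Kill_class_def elt_set_plus_def[of "p +o _"] tensor_power_def quot_def
  by (auto simp: killing_map_coset coset_add[OF subspace_symmetric_rels] image_image)

lemma subspace_words: "free.subspace (words n)"
proof -
  have "Poly_Mapping.keys (fscale c p) \<subseteq> Poly_Mapping.keys p" for c and p :: "'g list \<Rightarrow>\<^sub>0 'k"
    by (auto simp: in_keys_iff)
  then show ?thesis
    unfolding free.subspace_def words_def using keys_add by fastforce
qed

text \<open>The sums of this form make up a subspace containing both kinds of generators of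
  \<open>killing_rels\<close>. The two summands match the two stages of the quotient:
  \<open>s\<close> dies in the symmetric square, \<open>q\<close> comes from the third tensor
  power.\<close>

lemma killing_rels_decompose:
  assumes "p \<in> killing_rels"
  obtains s q where "s \<in> symmetric_rels 2" "q \<in> words 3" "p = s + lin_ext killing_word q"
proof -
  let ?T = "{s + lin_ext killing_word q | s q. s \<in> symmetric_rels 2 \<and> q \<in> words 3}"
  have "free.subspace ?T"
    unfolding free.subspace_def
  proof (intro conjI ballI allI)
    show "0 \<in> ?T"
      using free.subspace_0[OF subspace_symmetric_rels, of 2] free.subspace_0[OF subspace_words, of 3]
      by (intro CollectI exI[of _ 0]) simp
  next
    fix x y assume "x \<in> ?T" "y \<in> ?T"
    then obtain s q s' q' where *: "x = s + lin_ext killing_word q" "y = s' + lin_ext killing_word q'"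
      and mem: "s \<in> symmetric_rels 2" "q \<in> words 3" "s' \<in> symmetric_rels 2" "q' \<in> words 3" by blast
    have "x + y = (s + s') + lin_ext killing_word (q + q')"
      by (simp add: * lin_ext_add)
    moreover have "s + s' \<in> symmetric_rels 2" "q + q' \<in> words 3"
      by (intro free.subspace_add subspace_symmetric_rels subspace_words mem)+
    ultimately show "x + y \<in> ?T" by blast
  next
    fix c x assume "x \<in> ?T"
    then obtain s q where *: "x = s + lin_ext killing_word q"
      and mem: "s \<in> symmetric_rels 2" "q \<in> words 3" by blast
    have "fscale c x = fscale c s + lin_ext killing_word (fscale c q)"
      by (simp add: * lin_ext_fscale free.scale_right_distrib)
    moreover have "fscale c s \<in> symmetric_rels 2" "fscale c q \<in> words 3"
      by (intro free.subspace_scale subspace_symmetric_rels subspace_words mem)+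
    ultimately show "fscale c x \<in> ?T" by blast
  qed
  moreover have "s \<in> ?T" if "s \<in> symmetric_rels 2" for s
    using that free.subspace_0[OF subspace_words, of 3]
    by (intro CollectI exI[of _ s] exI[of _ 0]) simp
  moreover have "killing_word [x, y, z] \<in> ?T" for x y z
  proof -
    have "basis [x, y, z] \<in> words 3"
      by (simp add: words_def basis_def)
    then show ?thesis
      using free.subspace_0[OF subspace_symmetric_rels, of 2]
      by (intro CollectI exI[of _ 0] exI[of _ "basis [x, y, z]"]) (simp del: killing_word.simps)
  qed
  ultimately have "killing_rels \<subseteq> ?T"
    unfolding killing_rels_def by (intro free.span_minimal) auto
  then show thesis using assms that by blast
qed

text \<open>This turns membership in a subspace of the free space into equality in the two-stage
  quotient. The part of \<open>p - p'\<close> in the symmetric relations disappears in the coset,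
  and the rest is absorbed by shifting \<open>q\<close>; the reverse inclusion follows by
  symmetry.\<close>

lemma Kill_class_cong:
  assumes "p - p' \<in> killing_rels"
  shows "Kill_class p = Kill_class p'"
proof -
  have sub: "Kill_class p \<subseteq> Kill_class p'" if d: "p - p' \<in> killing_rels" for p p'
  proof
    fix C assume "C \<in> Kill_class p"
    then obtain q where q: "q \<in> words 3" and C: "C = (p + lin_ext killing_word q) +o symmetric_rels 2"
      unfolding Kill_class_eq by blast
    obtain s q' where s: "s \<in> symmetric_rels 2" and q': "q' \<in> words 3"
      and e: "p - p' = s + lin_ext killing_word q'"
      using d by (rule killing_rels_decompose)
    have "C = (p' + lin_ext killing_word (q' + q)) +o symmetric_rels 2"
      unfolding C
    proof (rule coset_eq[OF subspace_symmetric_rels])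
      have "p + lin_ext killing_word q - (p' + lin_ext killing_word (q' + q)) = s"
        using e by (simp add: lin_ext_add algebra_simps)
      then show "p + lin_ext killing_word q - (p' + lin_ext killing_word (q' + q)) \<in> symmetric_rels 2"
        using s by simp
    qed
    then show "C \<in> Kill_class p'"
      unfolding Kill_class_eq using free.subspace_add[OF subspace_words q' q] by blast
  qed
  have "p' - p \<in> killing_rels"
    using free.subspace_neg[OF subspace_killing_rels assms] by simp
  then show ?thesis using sub assms by blast
qed

text \<open>The Killing relation for \<open>x, x, z\<close> reads
  \<open>0 \<odot> z = x \<odot> [x, z]\<close>, which settles \<open>a = b\<close>. The case
  \<open>a = c\<close> reduces to it by anticommutativity, and for \<open>b = c\<close> the bracket
  is zero.\<close>

lemma koszul_word_exterior:
  assumes "length xs = 3" "\<not> distinct xs"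
  shows "koszul_word xs \<in> killing_rels"
proof -
  obtain a b c where xs: "xs = [a, b, c]" using assms(1) by (rule length_3_cases)
  have zero: "basis [0, z] \<in> killing_rels" "basis [z, 0] \<in> killing_rels" for z
    using zero_in_tensor_rels[of "[]" "[z]" 2] zero_in_tensor_rels[of "[z]" "[]" 2]
      tensor_rels_subset_killing_rels by auto
  have repeat_left: "basis [x, bracket x z] \<in> killing_rels" for x z
    using free.subspace_diff[OF subspace_killing_rels zero(1)[of z] killing_word_in_killing_rels[of x x z]]
    by (simp add: alternating)
  consider "a = b" | "a = c" | "b = c" using assms(2) xs by auto
  then show ?thesis
  proof cases
    case 1
    then show ?thesis by (simp add: xs repeat_left)
  next
    case 2
    have "basis [a, - bracket a b] + basis [a, bracket a b] \<in> killing_rels"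
      using neg_in_tensor_rels[of "[a]" "[]" 2] tensor_rels_subset_killing_rels by auto
    from free.subspace_diff[OF subspace_killing_rels this repeat_left[of a b]] 2
    show ?thesis by (simp add: xs bracket_anticommute[of b c])
  next
    case 3
    then show ?thesis by (simp add: xs alternating zero)
  qed
qed

lemma koszul_coset: "koszul (p +o exterior_rels 3) = Kill_class (lin_ext koszul_word p)"
  unfolding koszul_def
proof (rule induced_coset[OF subspace_exterior_rels])
  fix r assume "r \<in> exterior_rels 3"
  then have "lin_ext koszul_word r \<in> killing_rels"
    by (intro lin_ext_exterior_rels[OF subspace_killing_rels multilinear_mod_mono[OF
            multilinear_mod_koszul_word tensor_rels_subset_killing_rels]] koszul_word_exterior)
  then show "Kill_class (lin_ext koszul_word (p + r)) = Kill_class (lin_ext koszul_word p)"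
    by (intro Kill_class_cong) (simp add: lin_ext_add)
qed

section \<open>Two-nilpotency, the projection onto the centre, and vanishing of the Koszul
  map\<close>

lemma two_nilpotentD:
  assumes two_nilpotent
  shows "bracket x (bracket y z) = 0"
proof -
  have "bracket y z \<in> bracket_space UNIV UNIV"
    unfolding bracket_space_def by (rule span_base) blast
  then have "bracket x (bracket y z) \<in> bracket_space UNIV (bracket_space UNIV UNIV)"
    unfolding bracket_space_def[of _ "bracket_space _ _"] by (intro span_base) blast
  then show ?thesis using assms unfolding two_nilpotent_def by simp
qed

definition center :: "'g set"
  where "center = {v. \<forall>x. bracket x v = 0}"

lemma subspace_center: "subspace center"
proof (rule subspaceI)
  show "0 \<in> center"
    using bracket_scale_right[of _ 0 0] by (simp add: center_def)
qed (simp_all add: center_def bracket_linear)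

lemma bracket_odot_center:
  assumes "v \<in> center"
  shows "basis [bracket x y, v] \<in> killing_rels"
proof -
  have zero: "basis [x, 0] \<in> killing_rels"
    using zero_in_tensor_rels[of "[x]" "[]" 2] tensor_rels_subset_killing_rels by auto
  from free.subspace_add[OF subspace_killing_rels killing_word_in_killing_rels[of x y v], of "basis [x, 0]"]
    zero assms
  show ?thesis by (simp add: center_def)
qed

text \<open>\<open>P\<close> is a linear left inverse, on the centre, of the identity map. It exists
  in any dimension, because a basis of a subspace extends to a basis of the whole space.\<close>

lemma center_projection:
  obtains P where "\<And>x. P x \<in> center" "\<And>v. v \<in> center \<Longrightarrow> P v = v"
    "\<And>x y. P (x + y) = P x + P y" "\<And>c x. P (c *s x) = c *s P x"
proof -
  interpret vp: vector_space_pair scale scale ..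
  obtain P where "P ` UNIV \<subseteq> center" "Vector_Spaces.linear scale scale P" "\<forall>v\<in>center. P v = v"
    using vp.linear_exists_left_inverse_on[OF linear_id subspace_center] by auto
  then show thesis
    by (intro that[of P]) (auto simp: Vector_Spaces.linear_iff)
qed

text \<open>Each boundary term has a bracket in front, and \<open>koszul_word\<close> joins the
  other two entries into a second bracket, which is central.\<close>

lemma koszul_boundary_word:
  assumes nil: two_nilpotent and "length xs = 4"
  shows "lin_ext koszul_word (boundary_word xs) \<in> killing_rels"
proof -
  obtain a b c d where xs: "xs = [a, b, c, d]" using assms(2) by (rule length_4_cases)
  have "basis [bracket x y, bracket z w] \<in> killing_rels" for x y z w
    using two_nilpotentD[OF nil] by (intro bracket_odot_center) (simp add: center_def)
  then show ?thesis
    by (simp add: xs boundary_word_4 lin_ext_add lin_ext_diff lin_ext_uminus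
        free.subspace_add free.subspace_diff free.subspace_neg subspace_killing_rels)
qed

lemma koszul_cycle:
  assumes nil: two_nilpotent and three: "(3::'k) \<noteq> 0"
    and p: "p \<in> words 3" and cycle: "lin_ext boundary_word p \<in> exterior_rels 2"
  shows "lin_ext koszul_word p \<in> killing_rels"
proof -
  obtain P where P: "\<And>x. P x \<in> center" "\<And>v. v \<in> center \<Longrightarrow> P v = v"
    "\<And>x y. P (x + y) = P x + P y" "\<And>c x. P (c *s x) = c *s P x"
    using center_projection by blast
  have P_bracket: "P (bracket x y) = bracket x y" for x y
    using two_nilpotentD[OF nil] by (intro P(2)) (simp add: center_def)
  \<comment> \<open>The difference is written as a sum with a multiple by \<open>- 1\<close> so that
    the closure of \<open>multilinear_mod\<close> under sums and scalar multiples applies.\<close>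
  define \<phi> :: "'g list \<Rightarrow> ('g list \<Rightarrow>\<^sub>0 'k)"
    where "\<phi> = (\<lambda>xs. basis [P (xs ! 0), xs ! 1] + fscale (- 1) (basis [xs ! 0, P (xs ! 1)]))"
  have "multilinear_mod 2 (tensor_rels 2) \<phi>"
    unfolding \<phi>_def
    by (intro multilinear_mod_add multilinear_mod_fscale subspace_tensor_rels multilinear_mod_2I)
      (simp_all add: P add_gens_2 scale_gens_2)
  then have \<phi>_multilinear: "multilinear_mod 2 killing_rels \<phi>"
    by (rule multilinear_mod_mono) (rule tensor_rels_subset_killing_rels)
  have swap: "basis [x, y] - basis [y, x] \<in> killing_rels" for x y
    using permuted_in_symmetric_rels[of "[x, y]" 2 "[y, x]"] symmetric_rels_subset_killing_rels by auto
  \<comment> \<open>On \<open>[x, x]\<close> the value is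
    \<open>P x \<odot> x - x \<odot> P x\<close>, zero by commutativity of the symmetric
    square.\<close>
  have \<phi>_alternating: "\<phi> xs \<in> killing_rels" if "length xs = 2" "\<not> distinct xs" for xs
    using that swap by (elim length_2_cases) (auto simp: \<phi>_def)
  have cycle': "lin_ext \<phi> (lin_ext boundary_word p) \<in> killing_rels"
    by (rule lin_ext_exterior_rels[OF subspace_killing_rels \<phi>_multilinear \<phi>_alternating cycle])
  have triple: "fscale 3 q = q + q + q" for q :: "'g list \<Rightarrow>\<^sub>0 'k"
    using free.scale_left_distrib[of 2 1 q] free.scale_left_distrib[of 1 1 q] by simp
  have word: "lin_ext \<phi> (boundary_word xs) + fscale 3 (koszul_word xs) \<in> killing_rels"
    if xs_3: "length xs = 3" for xs
  proof -
    obtain a b c where xs: "xs = [a, b, c]" using xs_3 by (rule length_3_cases)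
    let ?k = "\<lambda>x y z. basis [bracket x y, z] - basis [x, bracket y z] :: 'g list \<Rightarrow>\<^sub>0 'k"
    let ?c = "\<lambda>x y z. basis [bracket x y, P z] :: 'g list \<Rightarrow>\<^sub>0 'k"
    have neg: "basis [a, - bracket b c] + basis [a, bracket b c] \<in> killing_rels"
      using neg_in_tensor_rels[of "[a]" "[]" 2] tensor_rels_subset_killing_rels by auto
    \<comment> \<open>Each of the three boundary terms accounts for one copy of
      \<open>a \<odot> [b, c]\<close>: those of \<open>[a, b]\<close> and \<open>[a, c]\<close> by a
      Killing relation, the latter with the sign change \<open>[c, b] = - [b, c]\<close>, and that
      of \<open>[b, c]\<close> by commutativity. The terms \<open>?c\<close>, brackets times central
      elements, come from the second half of \<open>\<phi>\<close>.\<close>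
    have "lin_ext \<phi> (boundary_word xs) + fscale 3 (koszul_word xs) =
        ?k a c b - ?k a b c + (basis [a, - bracket b c] + basis [a, bracket b c])
        - (basis [bracket b c, a] - basis [a, bracket b c]) + ?c a b c - ?c a c b + ?c b c a"
      by (simp add: xs boundary_word_3 lin_ext_add lin_ext_diff lin_ext_uminus \<phi>_def P_bracket
          triple bracket_anticommute[of c b])
    also have "\<dots> \<in> killing_rels"
      by (intro free.subspace_add[OF subspace_killing_rels] free.subspace_diff[OF subspace_killing_rels]
          killing_word_in_killing_rels neg swap bracket_odot_center P(1))
    finally show ?thesis .
  qed
  have "lin_ext \<phi> (lin_ext boundary_word p) + fscale 3 (lin_ext koszul_word p) \<in> killing_rels"
    unfolding lin_ext_lin_ext lin_ext_fscale_fun[symmetric] lin_ext_add_fun[symmetric]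
    using p word by (intro lin_ext_in_subspace[OF subspace_killing_rels]) (auto simp: words_def)
  from free.subspace_diff[OF subspace_killing_rels this cycle']
  have "fscale 3 (lin_ext koszul_word p) \<in> killing_rels" by simp
  \<comment> \<open>Characteristic zero enters here: \<open>3\<close> is invertible.\<close>
  from free.subspace_scale[OF subspace_killing_rels this, of "1 / 3"] three
  show ?thesis by simp
qed

section \<open>Descent to homology\<close>

lemma reduced_koszul_eq_0:
  assumes nil: two_nilpotent and three: "(3::'k) \<noteq> 0" and h: "h \<in> homology 3"
  shows "reduced_koszul h = Kill_class 0"
proof -
  obtain c where c: "c \<in> cycles 3" and h_eq: "h = c +o boundaries 3"
    using h unfolding homology_def quot_def by blast
  obtain p where p: "p \<in> words 3" and c_eq: "c = p +o exterior_rels 3"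
    using c unfolding cycles_def exterior_power_def quot_def by blast
  have "lin_ext boundary_word p +o exterior_rels 2 = exterior_rels 2"
    using c boundary_coset[of 3 p] boundary_word_3_exterior by (simp add: cycles_def c_eq)
  then have cycle: "lin_ext koszul_word p \<in> killing_rels"
    by (intro koszul_cycle nil three p coset_eqD subspace_exterior_rels)
  have boundaries_eq: "boundaries 3 = (\<lambda>q. lin_ext boundary_word q +o exterior_rels 3) ` words 4"
    using boundary_coset[of 4] boundary_word_4_exterior
    by (simp add: boundaries_def exterior_power_def quot_def image_image)
  \<comment> \<open>Since \<open>reduced_koszul\<close> takes the common value of
    \<open>koszul\<close> on the class \<open>h\<close>, every representative \<open>c + b\<close>
    of \<open>h\<close> has to be evaluated.\<close>
  have "koszul (c + b) = Kill_class 0" if "b \<in> boundaries 3" for b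
  proof -
    obtain q where q: "q \<in> words 4" and b: "b = lin_ext boundary_word q +o exterior_rels 3"
      using \<open>b \<in> boundaries 3\<close> unfolding boundaries_eq by blast
    have "lin_ext koszul_word (lin_ext boundary_word q) \<in> killing_rels"
      unfolding lin_ext_lin_ext
      by (rule lin_ext_in_subspace[OF subspace_killing_rels])
        (use q koszul_boundary_word[OF nil] in \<open>auto simp: words_def\<close>)
    from free.subspace_add[OF subspace_killing_rels cycle this] show ?thesis
      by (simp add: c_eq b coset_add[OF subspace_exterior_rels] koszul_coset lin_ext_add Kill_class_cong)
  qed
  \<comment> \<open>Guarantees that \<open>h\<close> has an element, so that its image under
    \<open>koszul\<close> is a singleton rather than empty and \<open>the_elem\<close> is
    determined.\<close>
  moreover have "boundaries 3 \<noteq> {}"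
    using free.subspace_0[OF subspace_words, of 4] by (auto simp: boundaries_eq)
  ultimately have "koszul ` h = {Kill_class 0}"
    unfolding h_eq elt_set_plus_def by fastforce
  then show ?thesis by (simp add: reduced_koszul_def induced_def)
qed

end

text \<open>The zero of the Killing module is written as the class of \<open>0\<close>, and
  \<open>3\<close> is nonzero in a field of characteristic zero.\<close>

theorem corollary1p6:
  fixes scale :: "'k::field_char_0 \<Rightarrow> 'g::ab_group_add \<Rightarrow> 'g"
    and bracket :: "'g \<Rightarrow> 'g \<Rightarrow> 'g"
  assumes "lie_algebra scale bracket"
    and "lie_algebra.two_nilpotent scale bracket"
  shows "\<forall>h \<in> lie_algebra.homology scale bracket 3.
    lie_algebra.reduced_koszul scale bracket h = lie_algebra.Kill_class scale bracket 0"
  using lie_algebra.reduced_koszul_eq_0[OF assms] by simp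

end
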